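(* Let $n\ge 1$ and let $(a_n,a_{n-1},\dots,a_1)\in\mathbb{Z}^n$ be a fixed vector with $a_n\neq 0$, $a_i\ge 0$ for all $1\le i\le n$, and $\gcd(a_n,a_{n-1},\dots,a_1)=1$. Then $$S(a_n,a_{n-1},\dots,a_1)\subseteq V(a_n,a_{n-1},\dots,a_1)\cap S(1).$$ Moreover, $$\operatorname{dens}\big(S(a_n,a_{n-1},\dots,a_1)\big)=\prod_{p\text{ prime}}\Big(1-\frac{f_{a_n,a_{n-1},\dots,a_1}(p)}{p^2}\Big),$$ where, for a positive integer $\ell$, $$f_{a_n,a_{n-1},\dots,a_1}(\ell):=\big|\{1\le d\le \ell \;:\; a_nd^n+a_{n-1}d^{n-1}+\cdots+a_1d\equiv 0 \pmod{\ell}\}\big|.$$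
   Context: $\mathbb{N}$ denotes the positive integers and $\mathbb{Q}^+$ the positive rationals. For a vector $(a_n,\dots,a_1)\in\mathbb{Z}^n$ with $a_n\ne 0$, all $a_i\ge 0$ and $\gcd(a_n,\dots,a_1)=1$: - A point $(a,b)\in\mathbb{N}^2$ is $\mathcal{F}(a_n,\dots,a_1)$-visible if there exists $q\in\mathbb{Q}^+$ such that $b=q(a_na^n+a_{n-1}a^{n-1}+\cdots+a_1a)$ and there is no other point of $\mathbb{N}^2$ on the curve $y=q(a_nx^n+a_{n-1}x^{n-1}+\cdots+a_1x)$ between the origin and $(a,b)$ (i.e. no point $(a',b')\in\mathbb{N}^2$ on this curve with $a'<a$). The set of all $\mathcal{F}(a_n,\dots,a_1)$-visible points in $\mathbb{N}^2$ is denoted $V(a_n,\dots,a_1)$. - $S(a_n,\dots,a_1)=\{(a,b)\in\mathbb{N}^2 : \gcd(a_na^n+a_{n-1}a^{n-1}+\cdots+a_1a,\,b)=1\}$. In particular (case $n=1$, $a_1=1$), $S(1)=\{(a,b)\in\mathbb{N}^2:\gcd(a,b)=1\}$. - The density of a set $S\subseteq\mathbb{N}^2$ is $\operatorname{dens}(S)=\lim_{N\to\infty}\frac{|S\cap R_N|}{N^2}$, provided the limit exists, where $R_N=\{(a,b)\in\mathbb{Z}^2 : 1\le a,b\le N\}$ for $N\in\mathbb{N}$. *)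

theory Defs
  imports Complex_Main "HOL-Analysis.Infinite_Products" "HOL-Number_Theory.Cong"
begin

text \<open>
  A vector \<open>(a\<^sub>n, \<dots>, a\<^sub>1)\<close> of integers is given by its length \<open>n\<close> and a function
  \<open>a :: nat \<Rightarrow> int\<close>, of which only the values at the indices \<open>1, \<dots>, n\<close> are used.
  Points of \<open>\<nat>\<^sup>2\<close>, with \<open>\<nat>\<close> the positive integers, are pairs of type
  \<open>nat \<times> nat\<close> with both components positive.
\<close>

definition vec_poly :: "nat \<Rightarrow> (nat \<Rightarrow> int) \<Rightarrow> int \<Rightarrow> int" where
  "vec_poly n a x = (\<Sum>i=1..n. a i * x ^ i)"

definition curve_points :: "nat \<Rightarrow> (nat \<Rightarrow> int) \<Rightarrow> rat \<Rightarrow> (nat \<times> nat) set" where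
  "curve_points n a q =
     {(x, y). 0 < x \<and> 0 < y \<and> rat_of_nat y = q * rat_of_int (vec_poly n a (int x))}"

definition visible_points :: "nat \<Rightarrow> (nat \<Rightarrow> int) \<Rightarrow> (nat \<times> nat) set" where
  "visible_points n a =
     {(x, y). \<exists>q>0. (x, y) \<in> curve_points n a q \<and>
        \<not> (\<exists>x' y'. (x', y') \<in> curve_points n a q \<and> x' < x)}"

definition coprime_points :: "nat \<Rightarrow> (nat \<Rightarrow> int) \<Rightarrow> (nat \<times> nat) set" where
  "coprime_points n a =
     {(x, y). 0 < x \<and> 0 < y \<and> gcd (vec_poly n a (int x)) (int y) = 1}"

lemma coprime_points_1:
  "coprime_points 1 (\<lambda>_. 1) = {(x, y). 0 < x \<and> 0 < y \<and> gcd x y = 1}"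
  by (simp add: coprime_points_def vec_poly_def)

definition square_R :: "nat \<Rightarrow> (nat \<times> nat) set" where
  "square_R N = {1..N} \<times> {1..N}"

definition density_seq :: "(nat \<times> nat) set \<Rightarrow> nat \<Rightarrow> real" where
  "density_seq S N = real (card (S \<inter> square_R N)) / real N ^ 2"

text \<open>The value of \<open>dens\<close> is meaningful only if \<open>has_dens\<close> holds.\<close>

definition has_dens :: "(nat \<times> nat) set \<Rightarrow> bool" where
  "has_dens S \<longleftrightarrow> convergent (density_seq S)"

definition dens :: "(nat \<times> nat) set \<Rightarrow> real" where
  "dens S = lim (density_seq S)"

definition root_count :: "nat \<Rightarrow> (nat \<Rightarrow> int) \<Rightarrow> nat \<Rightarrow> nat" where
  "root_count n a l = card {d. 1 \<le> d \<and> d \<le> l \<and> [vec_poly n a (int d) = 0] (mod int l)}"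

text \<open>
  A product over the primes is the infinite product over all natural numbers of the following
  factors, which are \<open>1\<close> at the non-primes.
\<close>

definition euler_factor :: "nat \<Rightarrow> (nat \<Rightarrow> int) \<Rightarrow> nat \<Rightarrow> real" where
  "euler_factor n a p = (if prime p then 1 - real (root_count n a p) / real p ^ 2 else 1)"

end

theory Submission
  imports Defs "HOL-Computational_Algebra.Polynomial"
begin

text \<open>
  Write \<open>F\<close> for the polynomial with the coefficients \<open>a\<close> and \<open>f p\<close> for the number of its roots
  modulo \<open>p\<close>.

  \<^emph>\<open>Visibility.\<close> Two points \<open>(x, y)\<close>, \<open>(x', y')\<close> on a common curve satisfy
  \<open>y' * F x = y * F x'\<close>. If \<open>F x\<close> and \<open>y\<close> are coprime, then \<open>F x\<close> divides \<open>F x'\<close>; but \<open>F\<close> is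
  positive and strictly increasing on the positive integers, so \<open>x' < x\<close> is impossible
  (\<open>coprime_points_visible\<close>). Moreover \<open>x\<close> divides \<open>F x\<close>, as \<open>F\<close> has no constant term, so \<open>x\<close> is
  coprime to \<open>y\<close> as well.

  \<^emph>\<open>Density.\<close> A pair fails to lie in the coprime set exactly when some prime divides both
  \<open>F x\<close> and \<open>y\<close>. Excluding only the primes \<open>p \<le> z\<close> leaves a set that is periodic modulo the
  product of these primes, so that its density is the proportion of admissible pairs of residues; by
  the Chinese remainder theorem this is the product of the factors \<open>1 - f p / p\<^sup>2\<close> over
  \<open>p \<le> z\<close> (\<open>density_sifted_primes_upto\<close>). The pairs in the square of side \<open>N\<close> that only a larger
  prime excludes are few, uniformly in \<open>N\<close>: since \<open>p\<close> divides \<open>y \<le> N\<close>, only \<open>p \<le> N\<close> matters, and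
  each such prime accounts for at most \<open>(N / p) * f p * (N / p + 1) \<le> 2 n N\<^sup>2 / p\<^sup>2\<close> pairs. Here
  \<open>f p \<le> n\<close>, because the coefficients have no common prime factor and so \<open>F\<close> does not vanish
  identically modulo \<open>p\<close>. Summing over \<open>p > z\<close> bounds the error in the density by \<open>2 n / z\<close>
  (\<open>density_sifted_minus_coprime\<close>). Since this bound does not depend on \<open>N\<close>, letting first \<open>N\<close> and
  then \<open>z\<close> tend to infinity gives the existence of the density and its value. The bound
  \<open>f p \<le> n\<close> also makes the Euler product absolutely convergent.
\<close>

section \<open>Roots of integer polynomials modulo a prime\<close>

text \<open>
  The classical argument of Lagrange: a root \<open>r\<close> splits off a linear factor modulo \<open>p\<close>, and as \<open>p\<close> is
  prime, every root other than \<open>r\<close> is a root of the cofactor. Working with integer polynomials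
  instead of polynomials over the residue field, nonvanishing modulo \<open>p\<close> becomes the condition that
  the constant \<open>p\<close> does not divide the polynomial.
\<close>

lemma card_roots_mod_prime_le_degree:
  fixes P :: "int poly" and p :: nat
  assumes "prime p" "\<not> [:int p:] dvd P"
  shows "card {x. x < p \<and> int p dvd poly P (int x)} \<le> degree P"
  using assms(2)
proof (induction "degree P" arbitrary: P)
  case 0
  then obtain c where P: "P = [:c:]"
    by (metis degree_eq_zeroE)
  with 0 have "\<not> int p dvd c" by auto
  then show ?case by (simp add: P)
next
  case (Suc k)
  show ?case
  proof (cases "\<exists>r<p. int p dvd poly P (int r)")
    case False
    then have "{x. x < p \<and> int p dvd poly P (int x)} = {}" by auto
    then show ?thesis by (metis card.empty le0)
  next
    case True
    then obtain r where r: "r < p" "int p dvd poly P (int r)" by blast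
    define Q where "Q = synthetic_div P (int r)"
    have P: "P = [:- int r, 1:] * Q + [:poly P (int r):]"
      by (metis Q_def synthetic_div_correct')
    have "\<not> [:int p:] dvd Q"
    proof
      assume "[:int p:] dvd Q"
      moreover have "[:int p:] dvd [:poly P (int r):]"
        using r(2) by (simp only: const_poly_dvd_const_poly_iff)
      ultimately have "[:int p:] dvd P"
        by (subst P) (intro dvd_add dvd_mult)
      with Suc.prems show False by simp
    qed
    moreover have degQ: "degree Q = k"
      using Suc.hyps(2) by (simp add: Q_def degree_synthetic_div)
    ultimately have IH: "card {x. x < p \<and> int p dvd poly Q (int x)} \<le> k"
      using Suc.hyps(1) by blast
    have "{x. x < p \<and> int p dvd poly P (int x)} \<subseteq> insert r {x. x < p \<and> int p dvd poly Q (int x)}"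
    proof
      fix x assume x: "x \<in> {x. x < p \<and> int p dvd poly P (int x)}"
      have "poly P (int x) = (int x - int r) * poly Q (int x) + poly P (int r)"
        by (subst P) (simp add: algebra_simps)
      with x r(2) have "int p dvd (int x - int r) * poly Q (int x)"
        by (simp add: dvd_add_left_iff)
      then consider "int p dvd int x - int r" | "int p dvd poly Q (int x)"
        using assms(1) by (metis prime_dvd_mult_iff prime_nat_int_transfer)
      then show "x \<in> insert r {x. x < p \<and> int p dvd poly Q (int x)}"
      proof cases
        case 1
        then have "[x = r] (mod p)"
          by (simp add: cong_iff_dvd_diff flip: cong_int_iff)
        with x r(1) have "x = r"
          by (simp add: cong_def)
        then show ?thesis by simp
      qed (use x in auto)
    qed
    then have "card {x. x < p \<and> int p dvd poly P (int x)}
        \<le> card (insert r {x. x < p \<and> int p dvd poly Q (int x)})"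
      by (intro card_mono) auto
    also have "\<dots> \<le> Suc (card {x. x < p \<and> int p dvd poly Q (int x)})"
      by (rule card_insert_le_m1) auto
    finally show ?thesis using IH Suc.hyps(2) by simp
  qed
qed

lemma vec_poly_0 [simp]: "vec_poly n a 0 = 0"
  unfolding vec_poly_def by (intro sum.neutral) auto

lemma vec_poly_cong:
  assumes "[x = y] (mod m)"
  shows "[vec_poly n a x = vec_poly n a y] (mod m)"
  unfolding vec_poly_def by (intro cong_sum cong_mult cong_refl cong_pow assms)

lemma dvd_vec_poly_mod_iff:
  assumes "p dvd m"
  shows "int p dvd vec_poly n a (int (x mod m)) \<longleftrightarrow> int p dvd vec_poly n a (int x)"
proof -
  have "[int (x mod m) = int x] (mod int p)"
    using assms unfolding cong_int_iff by (simp add: cong_def mod_mod_cancel)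
  then show ?thesis
    by (intro cong_dvd_iff vec_poly_cong)
qed

text \<open>
  The definition counts roots among \<open>1, \<dots>, l\<close>, while remainders range over \<open>0, \<dots>, l - 1\<close>. The
  two counts agree because \<open>l\<close> and \<open>0\<close> are both roots, as the polynomial has no constant term.
\<close>

lemma root_count_eq_card_residues:
  assumes "l > 0"
  shows "root_count n a l = card {x. x < l \<and> int l dvd vec_poly n a (int x)}"
proof -
  have l: "int l dvd vec_poly n a (int l)"
    using dvd_vec_poly_mod_iff[of l l n a l] by simp
  define Z where "Z = {x. 0 < x \<and> x < l \<and> int l dvd vec_poly n a (int x)}"
  have fin: "finite Z"
    by (simp add: Z_def)
  have "{x. 1 \<le> x \<and> x \<le> l \<and> [vec_poly n a (int x) = 0] (mod int l)} = insert l Z"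
    using assms l by (auto simp: Z_def cong_0_iff)
  moreover have "{x. x < l \<and> int l dvd vec_poly n a (int x)} = insert 0 Z"
    using assms by (auto simp: Z_def intro!: gr0I)
  moreover have "l \<notin> Z" "0 \<notin> Z"
    by (auto simp: Z_def)
  ultimately show ?thesis
    using fin by (simp add: root_count_def)
qed

text \<open>
  The condition on the greatest common divisor prevents \<open>p\<close> from dividing all
  coefficients, in which case all \<open>p\<close> residues would be roots.
\<close>

lemma root_count_prime_le:
  assumes "prime p" "Gcd (a ` {1..n}) = 1"
  shows "root_count n a p \<le> n"
proof -
  define P where "P = (\<Sum>i=1..n. monom (a i) i)"
  have poly: "poly P x = vec_poly n a x" for x
    by (simp add: P_def vec_poly_def poly_sum poly_monom)
  have coeff: "coeff P i = a i" if "i \<in> {1..n}" for i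
    using that by (simp add: P_def coeff_sum)
  have "\<not> [:int p:] dvd P"
  proof
    assume "[:int p:] dvd P"
    then have "int p dvd a i" if "i \<in> {1..n}" for i
      using coeff[OF that] by (metis const_poly_dvd_iff)
    then have "int p dvd Gcd (a ` {1..n})"
      by (auto intro: Gcd_greatest)
    with assms show False by simp
  qed
  from card_roots_mod_prime_le_degree[OF assms(1) this]
  have "root_count n a p \<le> degree P"
    using assms(1) by (simp add: root_count_eq_card_residues poly prime_gt_0_nat)
  also have "degree P \<le> n"
    unfolding P_def by (intro degree_sum_le) (auto intro: order_trans[OF degree_monom_le])
  finally show ?thesis .
qed

section \<open>Residue classes in an interval\<close>

lemma card_residue_class_le:
  "card {x \<in> {1..N}. x mod m = r} \<le> N div m + 1"
proof -
  have "inj_on (\<lambda>x. x div m) {x \<in> {1..N}. x mod m = r}"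
    by (rule inj_onI) (metis (mono_tags, lifting) div_mult_mod_eq mem_Collect_eq)
  then have "card {x \<in> {1..N}. x mod m = r} = card ((\<lambda>x. x div m) ` {x \<in> {1..N}. x mod m = r})"
    by (simp add: card_image)
  also have "\<dots> \<le> card {0..N div m}"
    by (intro card_mono) (auto intro: div_le_mono)
  finally show ?thesis by simp
qed

lemma card_residue_class_ge:
  assumes "r < m"
  shows "N div m - 1 \<le> card {x \<in> {1..N}. x mod m = r}"
proof -
  \<comment> \<open>The block \<open>j = 0\<close> could contribute \<open>0\<close>, and the block \<open>j = N div m\<close> may be incomplete.\<close>
  have "(\<lambda>j. j * m + r) ` {1..<N div m} \<subseteq> {x \<in> {1..N}. x mod m = r}"
  proof safe
    fix j assume j: "j \<in> {1..<N div m}"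
    have "j * m + r \<le> (j + 1) * m"
      using assms by simp
    also have "\<dots> \<le> (N div m) * m"
      using j by (intro mult_right_mono) auto
    also have "\<dots> \<le> N" by simp
    finally show "j * m + r \<in> {1..N}"
      using j assms by (simp add: Suc_le_eq)
    show "(j * m + r) mod m = r"
      using assms by simp
  qed
  then have "card ((\<lambda>j. j * m + r) ` {1..<N div m}) \<le> card {x \<in> {1..N}. x mod m = r}"
    by (intro card_mono) auto
  moreover have "inj_on (\<lambda>j. j * m + r) {1..<N div m}"
    using assms by (auto simp: inj_on_def)
  ultimately show ?thesis by (simp add: card_image)
qed

text \<open>
  By the two preceding bounds the count differs from \<open>N / m\<close> by at most a constant.
\<close>

lemma residue_class_density:
  assumes "r < m"
  shows "(\<lambda>N. real (card {x \<in> {1..N}. x mod m = r}) / real N) \<longlonglongrightarrow> 1 / real m"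
proof (rule tendsto_sandwich)
  have m: "m > 0" using assms by simp
  have floor: "real (N div m) \<le> real N / real m" "real N / real m - 1 \<le> real (N div m)" for N
    using floor_correct[of "real N / real m"] unfolding floor_divide_of_nat_eq by auto
  have "1 / real m - 2 / real N \<le> real (card {x \<in> {1..N}. x mod m = r}) / real N"
    if N: "N > 0" for N
  proof -
    have "real N / real m - 2 \<le> real (card {x \<in> {1..N}. x mod m = r})"
      using floor(2)[of N] card_residue_class_ge[OF assms, of N] by linarith
    then have "(real N / real m - 2) / real N \<le> real (card {x \<in> {1..N}. x mod m = r}) / real N"
      by (intro divide_right_mono) auto
    then show ?thesis using N by (simp add: diff_divide_distrib)
  qed
  then show "\<forall>\<^sub>F N in sequentially.
      1 / real m - 2 / real N \<le> real (card {x \<in> {1..N}. x mod m = r}) / real N"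
    using eventually_gt_at_top[of 0] by (rule eventually_mono[rotated])
  have "real (card {x \<in> {1..N}. x mod m = r}) / real N \<le> 1 / real m + 1 / real N"
    if N: "N > 0" for N
  proof -
    have "real (card {x \<in> {1..N}. x mod m = r}) \<le> real N / real m + 1"
      using floor(1)[of N] card_residue_class_le[of N m r] by linarith
    then have "real (card {x \<in> {1..N}. x mod m = r}) / real N \<le> (real N / real m + 1) / real N"
      by (intro divide_right_mono) auto
    then show ?thesis using N by (simp add: add_divide_distrib)
  qed
  then show "\<forall>\<^sub>F N in sequentially.
      real (card {x \<in> {1..N}. x mod m = r}) / real N \<le> 1 / real m + 1 / real N"
    using eventually_gt_at_top[of 0] by (rule eventually_mono[rotated])
  show "(\<lambda>N. 1 / real m - 2 / real N) \<longlonglongrightarrow> 1 / real m"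
    using tendsto_diff[OF tendsto_const lim_const_over_n[of 2]] by simp
  show "(\<lambda>N. 1 / real m + 1 / real N) \<longlonglongrightarrow> 1 / real m"
    using tendsto_add[OF tendsto_const lim_const_over_n[of 1]] by simp
qed

section \<open>Periodic sets of pairs\<close>

text \<open>
  Periodicity is expressed through remainders, not translations, because this is the form in which
  the Chinese remainder theorem and the splitting into residue classes use it.
\<close>

definition periodic_mod :: "nat \<Rightarrow> (nat \<times> nat) set \<Rightarrow> bool" where
  "periodic_mod m A \<longleftrightarrow> (\<forall>x y. (x mod m, y mod m) \<in> A \<longleftrightarrow> (x, y) \<in> A)"

definition residue_pairs :: "nat \<Rightarrow> (nat \<times> nat) set \<Rightarrow> (nat \<times> nat) set" where
  "residue_pairs m A = A \<inter> ({..<m} \<times> {..<m})"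

lemma finite_residue_pairs [simp]: "finite (residue_pairs m A)"
  by (simp add: residue_pairs_def)

text \<open>
  The set is a disjoint union of products of two residue classes, one product for each pair of
  residues in it, and each of these products has density \<open>1 / m\<^sup>2\<close>.
\<close>

lemma density_periodic:
  assumes "m > 0" "periodic_mod m A"
  shows "density_seq A \<longlonglongrightarrow> real (card (residue_pairs m A)) / real m ^ 2"
proof -
  define C where "C N r = {x \<in> {1..N}. x mod m = r}" for N r
  have finC: "finite (C N r)" for N r
    by (simp add: C_def)
  have split: "A \<inter> square_R N = (\<Union>(r, s)\<in>residue_pairs m A. C N r \<times> C N s)" for N
  proof (rule set_eqI, clarify)
    fix x y
    have "(x, y) \<in> A \<longleftrightarrow> (x mod m, y mod m) \<in> residue_pairs m A"
      using assms by (auto simp: residue_pairs_def periodic_mod_def)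
    then show "(x, y) \<in> A \<inter> square_R N \<longleftrightarrow> (x, y) \<in> (\<Union>(r, s)\<in>residue_pairs m A. C N r \<times> C N s)"
      by (auto simp: square_R_def C_def)
  qed
  have "card (A \<inter> square_R N) = (\<Sum>(r, s)\<in>residue_pairs m A. card (C N r) * card (C N s))" for N
    unfolding split
    by (subst card_UN_disjoint) (auto simp: C_def case_prod_beta intro!: sum.cong card_cartesian_product)
  then have eq: "density_seq A
      = (\<lambda>N. \<Sum>(r, s)\<in>residue_pairs m A. (real (card (C N r)) / real N) * (real (card (C N s)) / real N))"
    by (simp add: density_seq_def fun_eq_iff sum_divide_distrib case_prod_beta power2_eq_square)
  have "density_seq A \<longlonglongrightarrow> (\<Sum>(r, s)\<in>residue_pairs m A. (1 / real m) * (1 / real m))"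
    unfolding eq C_def case_prod_beta
    by (intro tendsto_sum tendsto_mult residue_class_density) (auto simp: residue_pairs_def)
  then show ?thesis
    by (simp add: power2_eq_square case_prod_beta)
qed

text \<open>
  The Chinese remainder theorem in each coordinate identifies pairs of residues modulo \<open>m * k\<close> with
  pairs of residues modulo \<open>m\<close> and modulo \<open>k\<close>, chosen independently. This multiplicativity is
  what turns the density of the sifted set into a product over primes.
\<close>

lemma card_residue_pairs_Int:
  assumes "coprime m k" "m > 0" "k > 0" "periodic_mod m A" "periodic_mod k B"
  shows "card (residue_pairs (m * k) (A \<inter> B)) = card (residue_pairs m A) * card (residue_pairs k B)"
proof -
  let ?g = "\<lambda>(x, y). ((x mod m, y mod m), (x mod k, y mod k))"
  have unique: "x = x'" if "x < m * k" "x' < m * k" "x mod m = x' mod m" "x mod k = x' mod k"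
    for x x' :: nat
  proof -
    have "[x = x'] (mod m * k)"
      using that assms(1) by (intro coprime_cong_mult_nat) (auto simp: cong_def)
    with that show ?thesis by (simp add: cong_def)
  qed
  have lift: "\<exists>x<m * k. x mod m = r \<and> x mod k = s" if "r < m" "s < k" for r s
    using binary_chinese_remainder_unique_nat[of m k r s] assms that
    by (metis cong_def less_not_refl mod_less)
  have "bij_betw ?g (residue_pairs (m * k) (A \<inter> B)) (residue_pairs m A \<times> residue_pairs k B)"
    unfolding bij_betw_def
  proof
    show "inj_on ?g (residue_pairs (m * k) (A \<inter> B))"
      by (auto simp: inj_on_def residue_pairs_def intro: unique)
    show "?g ` residue_pairs (m * k) (A \<inter> B) = residue_pairs m A \<times> residue_pairs k B"
    proof safe
      fix r r' s s'
      assume rs: "(r, r') \<in> residue_pairs m A" "(s, s') \<in> residue_pairs k B"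
      then obtain x y where xy: "x < m * k" "x mod m = r" "x mod k = s"
          "y < m * k" "y mod m = r'" "y mod k = s'"
        using lift[of r s] lift[of r' s'] by (auto simp: residue_pairs_def)
      then have "(x, y) \<in> residue_pairs (m * k) (A \<inter> B)"
        using rs assms(4,5) by (auto simp: residue_pairs_def periodic_mod_def)
      then show "((r, r'), (s, s')) \<in> ?g ` residue_pairs (m * k) (A \<inter> B)"
        using xy by (intro image_eqI[of _ _ "(x, y)"]) auto
    qed (use assms in \<open>auto simp: residue_pairs_def periodic_mod_def\<close>)
  qed
  from bij_betw_same_card[OF this] show ?thesis
    by (simp only: card_cartesian_product)
qed

section \<open>Sieving by finitely many primes\<close>

definition sifted_pairs :: "nat \<Rightarrow> (nat \<Rightarrow> int) \<Rightarrow> nat set \<Rightarrow> (nat \<times> nat) set" where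
  "sifted_pairs n a Q = {(x, y). \<forall>p\<in>Q. \<not> (int p dvd vec_poly n a (int x) \<and> p dvd y)}"

lemma periodic_sifted_pairs:
  assumes "\<And>p. p \<in> Q \<Longrightarrow> p dvd m"
  shows "periodic_mod m (sifted_pairs n a Q)"
  using assms by (auto simp: periodic_mod_def sifted_pairs_def dvd_vec_poly_mod_iff dvd_mod_iff)

text \<open>
  The excluded pairs of residues are \<open>(r, 0)\<close> with \<open>r\<close> a root modulo \<open>p\<close>. The identity is stated
  as a sum to avoid truncated subtraction.
\<close>

lemma card_residue_pairs_sifted_single:
  assumes "p > 0"
  shows "card (residue_pairs p (sifted_pairs n a {p})) + root_count n a p = p ^ 2"
proof -
  define Z where "Z = {x. x < p \<and> int p dvd vec_poly n a (int x)}"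
  have "residue_pairs p (sifted_pairs n a {p}) = {..<p} \<times> {..<p} - Z \<times> {0}"
    by (auto simp: residue_pairs_def sifted_pairs_def Z_def dest: dvd_imp_le)
  moreover have "Z \<times> {0} \<subseteq> {..<p} \<times> {..<p}"
    using assms by (auto simp: Z_def)
  moreover have "card (Z \<times> {0::nat}) \<le> card ({..<p} \<times> {..<p})"
    using calculation(2) by (intro card_mono) auto
  ultimately show ?thesis
    using assms
    by (simp add: card_Diff_subset finite_subset root_count_eq_card_residues Z_def
        card_cartesian_product power2_eq_square)
qed

text \<open>
  By induction on the set of primes: each further prime is coprime to the product of the others, so
  it contributes its own factor.
\<close>

lemma residue_density_sifted:
  assumes "finite Q" "\<And>p. p \<in> Q \<Longrightarrow> prime p"
  shows "real (card (residue_pairs (\<Prod>Q) (sifted_pairs n a Q))) / real (\<Prod>Q) ^ 2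
    = (\<Prod>p\<in>Q. euler_factor n a p)"
  using assms
proof (induction Q rule: finite_induct)
  case empty
  have "residue_pairs 1 (sifted_pairs n a {}) = {(0, 0)}"
    by (auto simp: residue_pairs_def sifted_pairs_def)
  then show ?case by simp
next
  case (insert p Q)
  have p: "prime p" "p > 0" and Q: "\<And>q. q \<in> Q \<Longrightarrow> prime q"
    using insert.prems by (auto simp: prime_gt_0_nat)
  have pos: "\<Prod>Q > 0"
    using Q by (intro prod_pos) (auto simp: prime_gt_0_nat)
  have cop: "coprime p (\<Prod>Q)"
    using p(1) Q insert.hyps(2) by (intro prod_coprime_right) (metis primes_coprime)
  have "sifted_pairs n a (insert p Q) = sifted_pairs n a {p} \<inter> sifted_pairs n a Q"
    by (auto simp: sifted_pairs_def)
  moreover have "periodic_mod p (sifted_pairs n a {p})"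
    by (rule periodic_sifted_pairs) simp
  moreover have "periodic_mod (\<Prod>Q) (sifted_pairs n a Q)"
    using insert.hyps(1) by (intro periodic_sifted_pairs) (metis dvd_prodI id_apply)
  ultimately have "card (residue_pairs (p * \<Prod>Q) (sifted_pairs n a (insert p Q)))
      = card (residue_pairs p (sifted_pairs n a {p})) * card (residue_pairs (\<Prod>Q) (sifted_pairs n a Q))"
    using cop p(2) pos by (simp add: card_residue_pairs_Int)
  moreover have "real (card (residue_pairs p (sifted_pairs n a {p}))) / real p ^ 2 = euler_factor n a p"
  proof -
    have "real (card (residue_pairs p (sifted_pairs n a {p}))) = real p ^ 2 - real (root_count n a p)"
      using card_residue_pairs_sifted_single[OF p(2), of n a]
      by (metis add_diff_cancel_right' of_nat_add of_nat_power)
    then show ?thesis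
      using p by (simp add: euler_factor_def diff_divide_distrib)
  qed
  ultimately show ?case
    using insert.hyps insert.IH[OF Q]
    by (simp add: power_mult_distrib flip: times_divide_times_eq)
qed

definition primes_upto :: "nat \<Rightarrow> nat set" where
  "primes_upto z = {p. prime p \<and> p \<le> z}"

lemma density_sifted_primes_upto:
  "density_seq (sifted_pairs n a (primes_upto z)) \<longlonglongrightarrow> (\<Prod>p\<le>z. euler_factor n a p)"
proof -
  have fin: "finite (primes_upto z)"
    by (rule finite_subset[of _ "{..z}"]) (auto simp: primes_upto_def)
  have prime: "prime p" if "p \<in> primes_upto z" for p
    using that by (simp add: primes_upto_def)
  have "\<Prod>(primes_upto z) > 0"
    by (intro prod_pos) (auto dest: prime simp: prime_gt_0_nat)
  then have "density_seq (sifted_pairs n a (primes_upto z))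
      \<longlonglongrightarrow> (\<Prod>p\<in>primes_upto z. euler_factor n a p)"
    using density_periodic[of "\<Prod>(primes_upto z)" "sifted_pairs n a (primes_upto z)"]
      residue_density_sifted[OF fin prime] periodic_sifted_pairs[OF dvd_prodI[OF fin]]
    by simp
  also have "(\<Prod>p\<in>primes_upto z. euler_factor n a p) = (\<Prod>p\<le>z. euler_factor n a p)"
    by (rule prod.mono_neutral_left) (auto simp: primes_upto_def euler_factor_def)
  finally show ?thesis .
qed

section \<open>The contribution of the large primes\<close>

text \<open>
  Telescoping, by \<open>1 / (k + 1)\<^sup>2 \<le> 1 / k - 1 / (k + 1)\<close>.
\<close>

lemma sum_inverse_squares_tail_le:
  assumes "z > 0"
  shows "(\<Sum>k\<in>{z<..N}. 1 / real k ^ 2) \<le> 1 / real z"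
proof (cases "z \<le> N")
  case True
  then have "(\<Sum>k\<in>{z<..N}. 1 / real k ^ 2) \<le> 1 / real z - 1 / real N"
  proof (induction N rule: dec_induct)
    case (step k)
    have "{z<..Suc k} = insert (Suc k) {z<..k}"
      using step.hyps by auto
    moreover have "1 / real (Suc k) ^ 2 \<le> 1 / real k - 1 / real (Suc k)"
    proof -
      have "real k > 0" using step.hyps(1) assms by simp
      then show ?thesis by (simp add: divide_simps) (simp add: algebra_simps power2_eq_square)
    qed
    ultimately show ?case using step.IH by simp
  qed simp
  then show ?thesis
    by (rule order_trans) simp
qed simp

text \<open>
  There are at most \<open>N / p\<close> choices for \<open>y\<close>, and \<open>x\<close> lies in one of at most \<open>n\<close> residue classes,
  each with at most \<open>N / p + 1\<close> elements. The assumption \<open>p \<le> N\<close> absorbs the summand \<open>1\<close> into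
  \<open>2 * N / p\<close>, which leaves a bound that is summable over \<open>p\<close>.
\<close>

lemma card_common_prime_le:
  assumes "prime p" "p \<le> N" "Gcd (a ` {1..n}) = 1"
  shows "real (card ({x \<in> {1..N}. int p dvd vec_poly n a (int x)} \<times> {y \<in> {1..N}. p dvd y}))
    \<le> 2 * real n * real N ^ 2 * (1 / real p ^ 2)"
proof -
  have p: "p > 0" using assms(1) by (simp add: prime_gt_0_nat)
  define X where "X = {x \<in> {1..N}. int p dvd vec_poly n a (int x)}"
  define Z where "Z = {r. r < p \<and> int p dvd vec_poly n a (int r)}"
  have "{y \<in> {1..N}. p dvd y} \<subseteq> (\<lambda>j. j * p) ` {1..N div p}"
  proof
    fix y assume y: "y \<in> {y \<in> {1..N}. p dvd y}"
    then have "y = (y div p) * p" "y div p \<in> {1..N div p}"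
      using p by (auto simp: div_le_mono Suc_le_eq div_greater_zero_iff dvd_imp_le)
    then show "y \<in> (\<lambda>j. j * p) ` {1..N div p}" by blast
  qed
  then have "card {y \<in> {1..N}. p dvd y} \<le> N div p"
    using surj_card_le[of "{1..N div p}"] by force
  then have Y: "real (card {y \<in> {1..N}. p dvd y}) \<le> real N / real p"
    using of_nat_div_le_of_nat[of N p, where ?'a = real] by linarith
  have "X \<subseteq> (\<Union>r\<in>Z. {x \<in> {1..N}. x mod p = r})"
    using p by (auto simp: X_def Z_def dvd_vec_poly_mod_iff)
  then have "card X \<le> card (\<Union>r\<in>Z. {x \<in> {1..N}. x mod p = r})"
    by (intro card_mono) (auto simp: Z_def)
  also have "\<dots> \<le> (\<Sum>r\<in>Z. card {x \<in> {1..N}. x mod p = r})"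
    by (rule card_UN_le) (simp add: Z_def)
  also have "\<dots> \<le> (\<Sum>r\<in>Z. N div p + 1)"
    by (intro sum_mono card_residue_class_le)
  finally have "card X \<le> card Z * (N div p + 1)" by simp
  moreover have "card Z \<le> n"
    using root_count_prime_le[OF assms(1,3)] p by (simp add: root_count_eq_card_residues Z_def)
  ultimately have "card X \<le> n * (N div p + 1)"
    by (meson le_trans mult_le_mono1)
  then have "real (card X) \<le> real n * (real (N div p) + 1)"
    by (metis of_nat_1 of_nat_add of_nat_le_iff of_nat_mult)
  also have "\<dots> \<le> real n * (2 * (real N / real p))"
  proof (intro mult_left_mono)
    have "1 \<le> real N / real p" using assms(2) p by simp
    then show "real (N div p) + 1 \<le> 2 * (real N / real p)"
      using of_nat_div_le_of_nat[of N p, where ?'a = real] by linarith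
  qed simp
  finally have "real (card X) * real (card {y \<in> {1..N}. p dvd y})
      \<le> (real n * (2 * (real N / real p))) * (real N / real p)"
    using Y by (intro mult_mono) auto
  then show ?thesis
    by (simp add: X_def card_cartesian_product power2_eq_square mult_ac)
qed

lemma coprime_points_subset_sifted:
  assumes "\<And>p. p \<in> Q \<Longrightarrow> prime p"
  shows "coprime_points n a \<subseteq> sifted_pairs n a Q"
proof clarify
  fix x y assume "(x, y) \<in> coprime_points n a"
  then have gcd: "gcd (vec_poly n a (int x)) (int y) = 1"
    by (simp add: coprime_points_def)
  have False if p: "p \<in> Q" "int p dvd vec_poly n a (int x)" "p dvd y" for p
  proof -
    have "int p dvd gcd (vec_poly n a (int x)) (int y)"
      using p by (simp add: int_dvd_int_iff)
    with gcd assms[OF p(1)] show False by simp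
  qed
  then show "(x, y) \<in> sifted_pairs n a Q"
    by (auto simp: sifted_pairs_def)
qed

text \<open>
  A pair that survives the sieve up to \<open>z\<close> without being coprime has a common prime divisor
  \<open>p > z\<close>, and \<open>p \<le> N\<close> because \<open>p\<close> divides the second coordinate. The resulting
  bound is uniform in \<open>N\<close>, which permits the exchange of the limits in \<open>N\<close> and \<open>z\<close>.
\<close>

lemma density_sifted_minus_coprime:
  assumes "z > 0" "Gcd (a ` {1..n}) = 1"
  shows "\<bar>density_seq (coprime_points n a) N - density_seq (sifted_pairs n a (primes_upto z)) N\<bar>
    \<le> 2 * real n / real z"
proof -
  define S where "S = coprime_points n a \<inter> square_R N"
  define T where "T = sifted_pairs n a (primes_upto z) \<inter> square_R N"
  define B where
    "B p = {x \<in> {1..N}. int p dvd vec_poly n a (int x)} \<times> {y \<in> {1..N}. p dvd y}" for p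
  define L where "L = {p \<in> {z<..N}. prime p}"
  have fin: "finite T" "finite L"
    by (simp_all add: T_def square_R_def L_def)
  have ST: "S \<subseteq> T"
    using coprime_points_subset_sifted[of "primes_upto z" n a]
    by (auto simp: S_def T_def primes_upto_def)
  have "T - S \<subseteq> (\<Union>p\<in>L. B p)"
  proof clarify
    fix x y assume xy: "(x, y) \<in> T" "(x, y) \<notin> S"
    then have R: "x \<in> {1..N}" "y \<in> {1..N}"
      by (auto simp: T_def square_R_def)
    with xy have "gcd (vec_poly n a (int x)) (int y) \<noteq> 1"
      by (auto simp: S_def T_def coprime_points_def)
    then have "nat (gcd (vec_poly n a (int x)) (int y)) \<noteq> 1"
      by simp
    then obtain p where p: "prime p" "p dvd nat (gcd (vec_poly n a (int x)) (int y))"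
      using prime_factor_nat by blast
    from p(2) have "int p dvd gcd (vec_poly n a (int x)) (int y)"
      by (metis gcd_ge_0_int int_dvd_int_iff int_nat_eq)
    then have dvd: "int p dvd vec_poly n a (int x)" "p dvd y"
      by (simp_all add: int_dvd_int_iff)
    have "p \<le> N"
      using dvd_imp_le[OF dvd(2)] R by simp
    moreover have "z < p"
    proof (rule ccontr)
      assume "\<not> z < p"
      then have "p \<in> primes_upto z"
        using p(1) by (simp add: primes_upto_def)
      with xy(1) dvd show False
        by (simp add: T_def sifted_pairs_def)
    qed
    ultimately show "(x, y) \<in> (\<Union>p\<in>L. B p)"
      using p(1) dvd R by (auto simp: L_def B_def)
  qed
  then have "card (T - S) \<le> card (\<Union>p\<in>L. B p)"
    using fin by (intro card_mono) (auto simp: B_def)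
  also have "\<dots> \<le> (\<Sum>p\<in>L. card (B p))"
    by (rule card_UN_le[OF fin(2)])
  finally have "real (card (T - S)) \<le> (\<Sum>p\<in>L. real (card (B p)))"
    by (metis of_nat_le_iff of_nat_sum)
  also have "\<dots> \<le> (\<Sum>p\<in>L. 2 * real n * real N ^ 2 * (1 / real p ^ 2))"
    unfolding B_def by (intro sum_mono card_common_prime_le assms) (auto simp: L_def)
  also have "\<dots> \<le> (\<Sum>p\<in>{z<..N}. 2 * real n * real N ^ 2 * (1 / real p ^ 2))"
    by (intro sum_mono2) (auto simp: L_def)
  also have "\<dots> = 2 * real n * real N ^ 2 * (\<Sum>p\<in>{z<..N}. 1 / real p ^ 2)"
    by (simp add: sum_distrib_left)
  also have "\<dots> \<le> 2 * real n * real N ^ 2 * (1 / real z)"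
    by (intro mult_left_mono sum_inverse_squares_tail_le assms) auto
  finally have card: "real (card T) - real (card S) \<le> 2 * real n * real N ^ 2 / real z"
    using ST fin by (simp add: card_Diff_subset finite_subset[OF ST] card_mono of_nat_diff)
  have le: "card S \<le> card T"
    using ST fin by (simp add: card_mono)
  \<comment> \<open>For \<open>N = 0\<close> both quotients are \<open>0 / 0 = 0\<close>.\<close>
  show ?thesis
  proof (cases "N = 0")
    case False
    have "\<bar>density_seq (coprime_points n a) N - density_seq (sifted_pairs n a (primes_upto z)) N\<bar>
        = (real (card T) - real (card S)) / real N ^ 2"
      using le
      by (simp add: density_seq_def S_def T_def abs_minus_commute divide_right_mono
          flip: diff_divide_distrib)
    also have "\<dots> \<le> (2 * real n * real N ^ 2 / real z) / real N ^ 2"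
      by (intro divide_right_mono card) simp
    finally show ?thesis using False by simp
  qed (simp add: density_seq_def)
qed

section \<open>The Euler product and the density\<close>

text \<open>
  The factors differ from \<open>1\<close> by at most \<open>n / p\<^sup>2\<close>.
\<close>

lemma convergent_euler_product:
  assumes "Gcd (a ` {1..n}) = 1"
  shows "convergent_prod (euler_factor n a)"
proof (rule abs_convergent_prod_imp_convergent_prod)
  have "summable (\<lambda>p. norm (euler_factor n a p - 1))"
  proof (rule summable_comparison_test')
    show "summable (\<lambda>p. real n * (1 / real p ^ 2))"
      using inverse_power_summable[of 2, where ?'a = real]
      by (intro summable_mult) (simp add: inverse_eq_divide)
    show "norm (norm (euler_factor n a p - 1)) \<le> real n * (1 / real p ^ 2)" for p
      using root_count_prime_le[OF _ assms, of p]
      by (auto simp: euler_factor_def divide_right_mono)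
  qed
  then show "abs_convergent_prod (euler_factor n a)"
    by (simp add: abs_convergent_prod_conv_summable)
qed

text \<open>
  The exchange of limits: \<open>E z\<close> is within \<open>\<delta> z\<close> of \<open>D\<close> along the whole sequence, so a single
  sufficiently large \<open>z\<close> makes all three errors in \<open>D N \<approx> E z N \<approx> P z \<approx> L\<close> small.
\<close>

lemma tendsto_from_uniform_approximation:
  fixes D :: "nat \<Rightarrow> real" and E :: "nat \<Rightarrow> nat \<Rightarrow> real"
  assumes lim: "\<And>z. E z \<longlonglongrightarrow> P z" and P: "P \<longlonglongrightarrow> L" and \<delta>: "\<delta> \<longlonglongrightarrow> 0"
    and approx: "\<And>z N. z > 0 \<Longrightarrow> \<bar>D N - E z N\<bar> \<le> \<delta> z"
  shows "D \<longlonglongrightarrow> L"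
proof (rule tendstoI)
  fix \<epsilon> :: real assume "\<epsilon> > 0"
  then have \<epsilon>: "\<epsilon> / 3 > 0" by simp
  have "\<forall>\<^sub>F z in sequentially. dist (P z) L < \<epsilon> / 3 \<and> dist (\<delta> z) 0 < \<epsilon> / 3 \<and> z > 0"
    by (intro eventually_conj tendstoD[OF P \<epsilon>] tendstoD[OF \<delta> \<epsilon>] eventually_gt_at_top)
  then obtain z where z: "dist (P z) L < \<epsilon> / 3" "dist (\<delta> z) 0 < \<epsilon> / 3" "z > 0"
    using eventually_happens[of _ sequentially] by auto
  show "\<forall>\<^sub>F N in sequentially. dist (D N) L < \<epsilon>"
    using tendstoD[OF lim[of z] \<epsilon>]
  proof eventually_elim
    case (elim N)
    then show ?case
      using z approx[of z N] unfolding dist_real_def by linarith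
  qed
qed

lemma density_coprime_points:
  assumes "Gcd (a ` {1..n}) = 1"
  shows "density_seq (coprime_points n a) \<longlonglongrightarrow> (\<Prod>p. euler_factor n a p)"
proof (rule tendsto_from_uniform_approximation[where
      E = "\<lambda>z. density_seq (sifted_pairs n a (primes_upto z))"])
  show "(\<lambda>z. \<Prod>p\<le>z. euler_factor n a p) \<longlonglongrightarrow> (\<Prod>p. euler_factor n a p)"
    by (intro convergent_prod_LIMSEQ convergent_euler_product assms)
  show "(\<lambda>z. 2 * real n / real z) \<longlonglongrightarrow> 0"
    by (rule lim_const_over_n)
qed (intro density_sifted_primes_upto density_sifted_minus_coprime assms; simp)+

section \<open>Visibility\<close>

lemma vec_poly_strict_mono:
  assumes "n \<ge> 1" "a n \<noteq> 0" "\<forall>i\<in>{1..n}. a i \<ge> 0" "0 \<le> x" "x < y"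
  shows "vec_poly n a x < vec_poly n a y"
  unfolding vec_poly_def
proof (rule sum_strict_mono_ex1)
  show "\<forall>i\<in>{1..n}. a i * x ^ i \<le> a i * y ^ i"
    using assms by (auto intro!: mult_left_mono power_mono)
  have "a n > 0"
    using assms(1-3) by (metis atLeastAtMost_iff order_le_less order_refl)
  moreover have "x ^ n < y ^ n"
    using assms by (intro power_strict_mono) auto
  ultimately show "\<exists>i\<in>{1..n}. a i * x ^ i < a i * y ^ i"
    using assms(1) by (intro bexI[of _ n]) auto
qed simp

text \<open>
  The only slope to consider is \<open>q = y / F x\<close>. An earlier point \<open>(x', y')\<close> on that curve would give
  \<open>y' * F x = y * F x'\<close>, hence \<open>F x dvd F x'\<close> by coprimality, against \<open>0 < F x' < F x\<close>.
\<close>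

lemma coprime_points_visible:
  assumes "n \<ge> 1" "a n \<noteq> 0" "\<forall>i\<in>{1..n}. a i \<ge> 0"
  shows "coprime_points n a \<subseteq> visible_points n a"
proof clarify
  fix x y assume "(x, y) \<in> coprime_points n a"
  then have pos: "0 < x" "0 < y" and gcd: "coprime (vec_poly n a (int x)) (int y)"
    by (auto simp: coprime_points_def coprime_iff_gcd_eq_1)
  let ?F = "\<lambda>x. vec_poly n a (int x)"
  have F_pos: "?F t > 0" if "t > 0" for t
    using vec_poly_strict_mono[OF assms, of 0 "int t"] that by simp
  define q where "q = rat_of_nat y / rat_of_int (?F x)"
  have q: "q > 0" "(x, y) \<in> curve_points n a q"
    using pos F_pos[OF pos(1)] by (auto simp: q_def curve_points_def)
  have False if "(x', y') \<in> curve_points n a q" "x' < x" for x' y'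
  proof -
    from that have x': "0 < x'" "rat_of_nat y' = q * rat_of_int (?F x')"
      by (auto simp: curve_points_def)
    have "rat_of_int (int y' * ?F x) = rat_of_int (int y * ?F x')"
      using x'(2) F_pos[OF pos(1)] by (simp add: q_def field_simps)
    then have "int y' * ?F x = int y * ?F x'"
      by (simp only: of_int_eq_iff)
    then have "?F x dvd int y * ?F x'"
      by (metis dvd_triv_right)
    with gcd have "?F x dvd ?F x'"
      by (simp add: coprime_dvd_mult_right_iff)
    then have "?F x \<le> ?F x'"
      using F_pos[OF x'(1)] by (rule zdvd_imp_le)
    moreover have "?F x' < ?F x"
      using that(2) by (intro vec_poly_strict_mono[OF assms]) auto
    ultimately show False by simp
  qed
  with q show "(x, y) \<in> visible_points n a"
    by (auto simp: visible_points_def)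
qed

lemma dvd_vec_poly: "x dvd vec_poly n a x"
  unfolding vec_poly_def by (intro dvd_sum dvd_mult dvd_power) auto

lemma coprime_points_subset_coprime_pairs:
  "coprime_points n a \<subseteq> coprime_points 1 (\<lambda>_. 1)"
proof clarify
  fix x y assume xy: "(x, y) \<in> coprime_points n a"
  then have "coprime (vec_poly n a (int x)) (int y)"
    by (simp add: coprime_points_def coprime_iff_gcd_eq_1)
  then have "coprime (int x) (int y)"
    using coprime_divisors[OF dvd_vec_poly dvd_refl] by blast
  with xy show "(x, y) \<in> coprime_points 1 (\<lambda>_. 1)"
    by (simp add: coprime_points_def vec_poly_def coprime_iff_gcd_eq_1)
qed

theorem theorem1p4:
  fixes n :: nat and a :: "nat \<Rightarrow> int"
  assumes "n \<ge> 1"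
    and "a n \<noteq> 0"
    and "\<forall>i\<in>{1..n}. a i \<ge> 0"
    and "Gcd (a ` {1..n}) = 1"
  shows "coprime_points n a \<subseteq> visible_points n a \<inter> coprime_points 1 (\<lambda>_. 1) \<and>
    has_dens (coprime_points n a) \<and>
    convergent_prod (euler_factor n a) \<and>
    dens (coprime_points n a) = (\<Prod>p. euler_factor n a p)"
proof (intro conjI)
  show "coprime_points n a \<subseteq> visible_points n a \<inter> coprime_points 1 (\<lambda>_. 1)"
    using coprime_points_visible[of n a] coprime_points_subset_coprime_pairs assms(1-3) by blast
  show "has_dens (coprime_points n a)"
    using density_coprime_points[OF assms(4)] by (auto simp: has_dens_def convergent_def)
  show "convergent_prod (euler_factor n a)"
    by (rule convergent_euler_product[OF assms(4)])
  show "dens (coprime_points n a) = (\<Prod>p. euler_factor n a p)"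
    unfolding dens_def by (rule limI[OF density_coprime_points[OF assms(4)]])
qed

end
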